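(* Let $p$ be a positive integer and let $(\mathbf{A}_n)_{n\in\mathbb{N}}$ be a sequence of matrices in $\mathbb{C}^{p\times p}$, determining a $Fib_p$ recurrence with kneading determinant $\Delta$ and extended kneading determinants $\Delta_\alpha(\beta)$. For every $\alpha=1,\dots,p$ and every vector $\boldsymbol{e}_\beta$ ($\beta\in\mathbb{Z}^+$) of the standard basis of $\boldsymbol{U}=\bigoplus_{n\in\mathbb{N}}\mathbb{C}^p$, the generating function $G_\alpha(\boldsymbol{e}_\beta)$ of the recurrence satisfies the following equality in $\mathbb{C}[[z]]$: $$zG_\alpha(\boldsymbol{e}_\beta)=1-\Delta^{-1}\Delta_\alpha(\beta).$$
   Context: $\mathbb{N}=\{0,1,2,\dots\}$; $\mathbb{C}[[z]]$ is the ring of formal power series. The $Fib_p$ recurrence determined by $(\mathbf{A}_n)_{n\in\mathbb{N}}$ is $\mathrm{x}_{n+1}=\sum_{i=0}^{+\infty}\mathbf{A}_i\mathrm{x}_{n-i}$, $n\in\mathbb{N}$, where $\mathrm{x}_n\in\mathbb{C}^p$ for all $n\in\mathbb{Z}$ and $\mathrm{x}_n=0$ for all but finitely many negative $n$. Space of initial conditions: $\boldsymbol{U}=\bigoplus_{n\in\mathbb{N}}\mathbb{C}^p$, with elements $\boldsymbol{u}=(\mathrm{u}_0,\mathrm{u}_1,\dots)$, finitely many $\mathrm{u}_n\in\mathbb{C}^p$ nonzero. If $\mathrm{e}_1,\dots,\mathrm{e}_p$ is the standard basis of $\mathbb{C}^p$, the standard basis $(\boldsymbol{e}_\beta)_{\beta\in\mathbb{Z}^+}$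 of $\boldsymbol{U}$ is ordered as $\boldsymbol{e}_1=(\mathrm{e}_1,0,0,\dots),\dots,\boldsymbol{e}_p=(\mathrm{e}_p,0,0,\dots)$, $\boldsymbol{e}_{p+1}=(0,\mathrm{e}_1,0,\dots),\dots,\boldsymbol{e}_{2p}=(0,\mathrm{e}_p,0,\dots)$, $\boldsymbol{e}_{2p+1}=(0,0,\mathrm{e}_1,0,\dots)$, and so on. Solutions: for $\boldsymbol{u}\in\boldsymbol{U}$, the solution with initial condition $\boldsymbol{u}$ is the unique sequence $\Theta(\boldsymbol{u})=(\mathrm{v}_n)_{n\in\mathbb{Z}}$ in $\mathbb{C}^p$ with $\mathrm{v}_n=\mathrm{u}_{-n}$ for all $n\le0$ and $\mathrm{v}_{n+1}=\sum_{i=0}^{+\infty}\mathbf{A}_i\mathrm{v}_{n-i}$ for all $n\ge0$. For $\alpha=1,\dots,p$, $G_\alpha(\boldsymbol{u})=\sum_{n\ge0}\mathrm{v}_n^{(\alpha)}z^n\in\mathbb{C}[[z]]$, where $\mathrm{v}_n^{(\alpha)}$ is the $\alpha$-th coordinate of $\mathrm{v}_n$. Kneading matrix and determinant: $\mathbf{K}=(K(i,j))\in\mathbb{C}[[z]]^{p\times p}$ with $K(i,j)=\sum_{n\ge0}A_n(i,j)z^n$, where $A_n(i,j)$ is the $(i,j)$ entry of $\mathbf{A}_n$; $\Delta=\det(\mathbf{I}-z\mathbf{K})$, an invertible formal power series. Extended kneading matrix and determinant: for $\alpha\in\{1,\dots,p\}$ and $\beta\in\mathbb{Z}^+$, $$\mathbf{K}_\alpha(\beta)=\begin{pmatrix}K(1,1)&\cdots&K(1,p)&K(1,\beta)\\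 \vdots&\ddots&\vdots&\vdots\\ K(p,1)&\cdots&K(p,p)&K(p,\beta)\\ \delta(\alpha,1)&\cdots&\delta(\alpha,p)&\delta(\alpha,\beta)\end{pmatrix}\in\mathbb{C}[[z]]^{(p+1)\times(p+1)},$$ where $\delta$ is the Kronecker delta and, with $q$ and $r$ the quotient and remainder of the division of $\beta$ by $p$, $K(i,\beta)=\sum_{n\ge0}A_{n+q-1}(i,p)z^n$ if $p$ divides $\beta$, and $K(i,\beta)=\sum_{n\ge0}A_{n+q}(i,r)z^n$ otherwise (consistent with $K(i,j)$ above when $\beta=j\le p$). Then $\Delta_\alpha(\beta)=\det(\mathbf{I}-z\mathbf{K}_\alpha(\beta))$. $\mathbf{I}$ denotes the identity matrix of the appropriate size. *)

theory Defs
  imports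
    "Jordan_Normal_Form.Determinant"
    "HOL-Computational_Algebra.Formal_Power_Series"
    "HOL-Library.Groups_Big_Fun"
    Complex_Main
begin

no_notation fps_nth (infixl "$" 75)

(* Vector and matrix entries are 0-based in the library; the parameters alpha and beta below
   are 1-based, so coordinate alpha is read off at index alpha - 1. *)

definition init_space :: "nat \<Rightarrow> (nat \<Rightarrow> complex vec) set" where
  "init_space p = {u. (\<forall>n. u n \<in> carrier_vec p) \<and> finite {n. u n \<noteq> 0\<^sub>v p}}"

(* For beta = k * p + j with 1 <= j <= p this is the sequence with the j-th standard basis
   vector in position k and zeros elsewhere. *)
definition init_basis :: "nat \<Rightarrow> nat \<Rightarrow> nat \<Rightarrow> complex vec" where
  "init_basis p \<beta> = (\<lambda>n. if n = (\<beta> - 1) div p then unit_vec p ((\<beta> - 1) mod p) else 0\<^sub>v p)"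

(* The infinite sum is taken coordinatewise; it has finitely many nonzero terms for every u in
   init_space p, see finite_support_fib_sum below. *)
definition is_fib_solution ::
  "nat \<Rightarrow> (nat \<Rightarrow> complex mat) \<Rightarrow> (nat \<Rightarrow> complex vec) \<Rightarrow> (int \<Rightarrow> complex vec) \<Rightarrow> bool" where
  "is_fib_solution p A u v \<longleftrightarrow>
     (\<forall>n. v n \<in> carrier_vec p) \<and>
     (\<forall>n\<le>0. v n = u (nat (- n))) \<and>
     (\<forall>n\<ge>0. v (n + 1) = vec p (\<lambda>a. Sum_any (\<lambda>i::nat. (A i *\<^sub>v v (n - int i)) $ a)))"

definition fib_solution ::
  "nat \<Rightarrow> (nat \<Rightarrow> complex mat) \<Rightarrow> (nat \<Rightarrow> complex vec) \<Rightarrow> int \<Rightarrow> complex vec" where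
  "fib_solution p A u = (THE v. is_fib_solution p A u v)"

definition gen_fun ::
  "nat \<Rightarrow> (nat \<Rightarrow> complex mat) \<Rightarrow> nat \<Rightarrow> (nat \<Rightarrow> complex vec) \<Rightarrow> complex fps" where
  "gen_fun p A \<alpha> u = Abs_fps (\<lambda>n. fib_solution p A u (int n) $ (\<alpha> - 1))"

definition kneading_mat :: "nat \<Rightarrow> (nat \<Rightarrow> complex mat) \<Rightarrow> complex fps mat" where
  "kneading_mat p A = mat p p (\<lambda>(i, j). Abs_fps (\<lambda>n. A n $$ (i, j)))"

definition kneading_det :: "nat \<Rightarrow> (nat \<Rightarrow> complex mat) \<Rightarrow> complex fps" where
  "kneading_det p A = det (1\<^sub>m p - fps_X \<cdot>\<^sub>m kneading_mat p A)"

(* K(i + 1, beta), with 0-based row i and 1-based beta. *)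
definition ext_entry :: "nat \<Rightarrow> (nat \<Rightarrow> complex mat) \<Rightarrow> nat \<Rightarrow> nat \<Rightarrow> complex fps" where
  "ext_entry p A i \<beta> =
     (if p dvd \<beta> then Abs_fps (\<lambda>n. A (n + \<beta> div p - 1) $$ (i, p - 1))
      else Abs_fps (\<lambda>n. A (n + \<beta> div p) $$ (i, \<beta> mod p - 1)))"

definition ext_kneading_mat ::
  "nat \<Rightarrow> (nat \<Rightarrow> complex mat) \<Rightarrow> nat \<Rightarrow> nat \<Rightarrow> complex fps mat" where
  "ext_kneading_mat p A \<alpha> \<beta> = mat (p + 1) (p + 1) (\<lambda>(i, j).
     if i < p then (if j < p then kneading_mat p A $$ (i, j) else ext_entry p A i \<beta>)
     else if \<alpha> = (if j < p then j + 1 else \<beta>) then 1 else 0)"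

definition ext_kneading_det ::
  "nat \<Rightarrow> (nat \<Rightarrow> complex mat) \<Rightarrow> nat \<Rightarrow> nat \<Rightarrow> complex fps" where
  "ext_kneading_det p A \<alpha> \<beta> = det (1\<^sub>m (p + 1) - fps_X \<cdot>\<^sub>m ext_kneading_mat p A \<alpha> \<beta>)"

lemma ext_entry_eq_kneading_mat:
  assumes "i < p" "1 \<le> j" "j \<le> p"
  shows "ext_entry p A i j = kneading_mat p A $$ (i, j - 1)"
proof (cases "j = p")
  case True
  then show ?thesis using assms by (simp add: ext_entry_def kneading_mat_def)
next
  case False
  then have "j < p" using assms by simp
  moreover from this have "\<not> p dvd j" using assms by (auto dest: dvd_imp_le)
  ultimately show ?thesis using assms by (simp add: ext_entry_def kneading_mat_def)
qed

lemma kneading_det_nth_0: "fps_nth (kneading_det p A) 0 = 1"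
proof -
  interpret h: comm_ring_hom "\<lambda>f :: complex fps. fps_nth f 0"
    by unfold_locales (auto simp: fps_mult_nth)
  have "map_mat (\<lambda>f. fps_nth f 0) (1\<^sub>m p - fps_X \<cdot>\<^sub>m kneading_mat p A) = 1\<^sub>m p"
    by (rule eq_matI) (auto simp: kneading_mat_def)
  then show ?thesis
    unfolding kneading_det_def h.hom_det[symmetric] by simp
qed

lemma kneading_det_invertible: "inverse (kneading_det p A) * kneading_det p A = 1"
  by (rule inverse_mult_eq_1) (simp add: kneading_det_nth_0)

lemma init_basis_in_init_space: "init_basis p \<beta> \<in> init_space p"
  by (auto simp: init_basis_def init_space_def)

lemma finite_support_fib_sum:
  assumes u: "u \<in> init_space p" and v: "is_fib_solution p A u v"
  shows "finite {i::nat. v (n - int i) \<noteq> 0\<^sub>v p}"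
proof -
  let ?S = "{k. u k \<noteq> 0\<^sub>v p}"
  have "{i::nat. v (n - int i) \<noteq> 0\<^sub>v p} \<subseteq> {i. int i < n} \<union> (\<lambda>k. nat (n + int k)) ` ?S"
  proof
    fix i :: nat assume i: "i \<in> {i. v (n - int i) \<noteq> 0\<^sub>v p}"
    show "i \<in> {i. int i < n} \<union> (\<lambda>k. nat (n + int k)) ` ?S"
    proof (cases "int i < n")
      case False
      then have "v (n - int i) = u (nat (int i - n))"
        using v by (simp add: is_fib_solution_def)
      then have "nat (int i - n) \<in> ?S" using i by simp
      moreover have "i = nat (n + int (nat (int i - n)))" using False by simp
      ultimately show ?thesis by blast
    qed simp
  qed
  moreover have "finite {i. int i < n}"
    by (rule finite_subset[of _ "{..nat n}"]) auto
  moreover have "finite ?S" using u by (simp add: init_space_def)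
  ultimately show ?thesis by (meson finite_subset finite_UnI finite_imageI)
qed

fun fib_rec :: "nat \<Rightarrow> (nat \<Rightarrow> complex mat) \<Rightarrow> (nat \<Rightarrow> complex vec) \<Rightarrow> nat \<Rightarrow> complex vec" where
  "fib_rec p A u 0 = u 0"
| "fib_rec p A u (Suc n) = vec p (\<lambda>a. Sum_any (\<lambda>i::nat.
     (A i *\<^sub>v (if i \<le> n then fib_rec p A u (n - i) else u (i - n))) $ a))"

lemma ex1_fib_solution:
  assumes u: "u \<in> init_space p"
  shows "\<exists>!v. is_fib_solution p A u v"
proof (rule ex_ex1I)
  let ?v = "\<lambda>n::int. if n \<le> 0 then u (nat (- n)) else fib_rec p A u (nat n)"
  have c: "u n \<in> carrier_vec p" for n using u by (simp add: init_space_def)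
  have "fib_rec p A u n \<in> carrier_vec p" for n by (cases n) (auto simp: c)
  moreover have "?v (n + 1) = vec p (\<lambda>a. Sum_any (\<lambda>i::nat. (A i *\<^sub>v ?v (n - int i)) $ a))"
    if "n \<ge> 0" for n :: int
  proof -
    obtain m where m: "n = int m" using \<open>n \<ge> 0\<close> nonneg_int_cases by blast
    have "?v (n - int i) = (if i \<le> m then fib_rec p A u (m - i) else u (i - m))" for i
      by (cases i m rule: linorder_cases) (auto simp: m nat_diff_distrib)
    moreover have "nat (n + 1) = Suc m" "\<not> n + 1 \<le> 0" using m by auto
    ultimately show ?thesis by simp
  qed
  ultimately have "is_fib_solution p A u ?v"
    by (auto simp: is_fib_solution_def c)
  then show "\<exists>v. is_fib_solution p A u v" by blast
next
  fix v w assume v: "is_fib_solution p A u v" and w: "is_fib_solution p A u w"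
  have neg: "v n = w n" if "n \<le> 0" for n
    using v w that by (simp add: is_fib_solution_def)
  have "\<forall>k \<le> int m. v k = w k" for m
  proof (induction m)
    case 0
    then show ?case using neg by simp
  next
    case (Suc m)
    have "v (int m + 1) = w (int m + 1)"
      using v w Suc by (simp add: is_fib_solution_def)
    then show ?case using Suc by (metis add.commute int_Suc order_le_less zless_add1_eq of_nat_Suc)
  qed
  then show "v = w" by (metis ext neg linorder_le_cases nonneg_int_cases order_refl)
qed

end

(* Let y be the generating vector of the solution with initial condition
   e_\<beta>, with its constant term removed. Since e_\<beta> has a single nonzero entry, the recurrence reads
   (I - z K) y = z b, where b = (K(i, \<beta>)) is the extra column of the extended kneading matrix.
   Clearing that column of I - z K_\<alpha>(\<beta>) by a column operation with y leaves the block determinant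
   \<Delta> (1 - z \<delta>(\<alpha>, \<beta>) - z y_\<alpha>). The constant term of G_\<alpha>(e_\<beta>) is exactly \<delta>(\<alpha>, \<beta>), so the last factor
   is 1 - z G_\<alpha>(e_\<beta>). *)

theory Submission
  imports Defs
begin

text \<open>Subtracting the first block column times \<open>Y\<close> from the second clears the
  upper right block: the matrix is \<open>?L * ?R\<close> with \<open>?L\<close> block lower
  triangular and \<open>?R\<close> unipotent. Writing that block as \<open>M * Y\<close> gives a
  Schur complement formula in which no inverse of \<open>M\<close> occurs.\<close>

lemma det_four_block_mat_right_multiple:
  fixes M :: "'a :: idom mat"
  assumes M: "M \<in> carrier_mat n n" and Y: "Y \<in> carrier_mat n m"
    and C: "C \<in> carrier_mat m n" and D: "D \<in> carrier_mat m m"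
  shows "det (four_block_mat M (M * Y) C D) = det M * det (D - C * Y)"
proof -
  let ?L = "four_block_mat M (0\<^sub>m n m) C (D - C * Y)"
  let ?R = "four_block_mat (1\<^sub>m n) Y (0\<^sub>m m n) (1\<^sub>m m)"
  have CY: "C * Y \<in> carrier_mat m m" using C Y by simp
  have DCY: "D - C * Y \<in> carrier_mat m m" using CY by (rule minus_carrier_mat)
  have "?L * ?R = four_block_mat (M * 1\<^sub>m n + 0\<^sub>m n m * 0\<^sub>m m n) (M * Y + 0\<^sub>m n m * 1\<^sub>m m)
      (C * 1\<^sub>m n + (D - C * Y) * 0\<^sub>m m n) (C * Y + (D - C * Y) * 1\<^sub>m m)"
    by (rule mult_four_block_mat[OF M _ C DCY _ Y]) auto
  moreover have "C * Y + (D - C * Y) * 1\<^sub>m m = D"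
    unfolding right_mult_one_mat[OF DCY] using CY D
    by (intro eq_matI) (auto simp del: index_mult_mat)
  moreover have "M * Y \<in> carrier_mat n m" using M Y by simp
  ultimately have "four_block_mat M (M * Y) C D = ?L * ?R"
    using M C right_mult_zero_mat[OF DCY] by simp
  moreover have "det ?L = det M * det (D - C * Y)"
    by (rule det_four_block_mat_upper_right_zero[OF M refl C DCY])
  moreover have "det ?R = 1"
    using det_four_block_mat_lower_left_zero[OF one_carrier_mat Y refl one_carrier_mat] by simp
  moreover have "?L \<in> carrier_mat (n + m) (n + m)" "?R \<in> carrier_mat (n + m) (n + m)"
    using M DCY by (auto intro: four_block_carrier_mat)
  ultimately show ?thesis by (simp add: det_mult)
qed

lemma is_fib_solution_fib_solution:
  assumes "u \<in> init_space p"
  shows "is_fib_solution p A u (fib_solution p A u)"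
  unfolding fib_solution_def by (rule theI'[OF ex1_fib_solution[OF assms]])

text \<open>Passing to \<beta> - 1 merges the two cases of the definition: its quotient and
  remainder by \<open>p\<close> are the position and the 0-based coordinate of the nonzero entry of
  \<open>init_basis p \<beta>\<close>.\<close>

lemma ext_entry_eq:
  assumes "p > 0" and "1 \<le> \<beta>"
  shows "ext_entry p A i \<beta> = Abs_fps (\<lambda>n. A (n + (\<beta> - 1) div p) $$ (i, (\<beta> - 1) mod p))"
proof -
  obtain b where b: "\<beta> = Suc b" using assms(2) by (cases \<beta>) auto
  show ?thesis
  proof (cases "p dvd \<beta>")
    case True
    then have "Suc (b mod p) = p" using b mod_Suc[of b p] by (auto split: if_splits)
    then have "\<beta> div p = Suc (b div p)" "b mod p = p - 1"
      using b True by (auto simp: div_Suc dvd_eq_mod_eq_0)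
    then show ?thesis using True b by (simp add: ext_entry_def)
  next
    case False
    then have "\<beta> div p = b div p" "\<beta> mod p = Suc (b mod p)"
      using b by (auto simp: div_Suc mod_Suc dvd_eq_mod_eq_0 split: if_splits)
    then show ?thesis using False b by (simp add: ext_entry_def)
  qed
qed

text \<open>The recurrence sum splits at \<open>i = n\<close>: smaller indices involve values at
  positive times, all others read the initial condition, whose single nonzero entry picks out one
  matrix entry.\<close>

lemma fib_solution_init_basis_Suc:
  fixes p \<beta> :: nat
  assumes "p > 0" and A: "\<And>n. A n \<in> carrier_mat p p" and a: "a < p"
  defines "v \<equiv> fib_solution p A (init_basis p \<beta>)"
  shows "v (int (Suc n)) $ a =
    (\<Sum>i<n. \<Sum>j<p. A i $$ (a, j) * v (int (n - i)) $ j)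
      + A (n + (\<beta> - 1) div p) $$ (a, (\<beta> - 1) mod p)"
proof -
  let ?q = "(\<beta> - 1) div p" and ?r = "(\<beta> - 1) mod p"
  let ?f = "\<lambda>i. (A i *\<^sub>v v (int n - int i)) $ a"
  have sol: "is_fib_solution p A (init_basis p \<beta>) v"
    unfolding v_def by (rule is_fib_solution_fib_solution[OF init_basis_in_init_space])
  have vc: "v k \<in> carrier_vec p" for k using sol by (simp add: is_fib_solution_def)
  have r: "?r < p" using \<open>p > 0\<close> by simp
  \<comment> \<open>The index \<open>i = n\<close> belongs to this part, since time 0 is already
    prescribed by the initial condition; hence the remaining sum runs over \<open>i < n\<close>
    only.\<close>
  have past: "?f i = (if i = n + ?q then A i $$ (a, ?r) else 0)" if "i \<ge> n" for i
  proof -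
    have "v (int n - int i) = init_basis p \<beta> (i - n)"
      using sol that by (simp add: is_fib_solution_def nat_diff_distrib)
    also have "\<dots> = (if i = n + ?q then unit_vec p ?r else 0\<^sub>v p)"
      using that by (auto simp: init_basis_def)
    finally have *: "v (int n - int i) = (if i = n + ?q then unit_vec p ?r else 0\<^sub>v p)" .
    have row: "row (A i) a \<in> carrier_vec p" "a < dim_row (A i)" using A[of i] a by auto
    have "row (A i) a \<bullet> unit_vec p ?r = A i $$ (a, ?r)"
      using A[of i] a r by (simp add: scalar_prod_right_unit[OF r])
    then show ?thesis unfolding * using row
      by (cases "i = n + ?q")
        (simp_all only: refl index_mult_mat_vec if_True if_False scalar_prod_right_zero)
  qed
  have present: "?f i = (\<Sum>j<p. A i $$ (a, j) * v (int (n - i)) $ j)" if "i < n" for i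
  proof -
    have "int n - int i = int (n - i)" using that by simp
    moreover have "(A i *\<^sub>v w) $ a = (\<Sum>j<p. A i $$ (a, j) * w $ j)" if "w \<in> carrier_vec p" for w
      using A[of i] a that by (simp add: scalar_prod_def atLeast0LessThan)
    ultimately show ?thesis using vc by (simp only:)
  qed
  have "v (int n + 1) = vec p (\<lambda>a. Sum_any (\<lambda>i. (A i *\<^sub>v v (int n - int i)) $ a))"
    using sol by (simp add: is_fib_solution_def)
  then have "v (int (Suc n)) $ a = Sum_any ?f" using a by (simp add: add.commute)
  also have "\<dots> = sum ?f (insert (n + ?q) {..<n})"
  proof (rule Sum_any.expand_superset)
    show "{i. ?f i \<noteq> 0} \<subseteq> insert (n + ?q) {..<n}"
    proof
      fix i assume "i \<in> {i. ?f i \<noteq> 0}"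
      then show "i \<in> insert (n + ?q) {..<n}"
        using past[of i] by (cases "i < n"; cases "i = n + ?q") simp_all
    qed
  qed simp
  also have "\<dots> = sum ?f {..<n} + ?f (n + ?q)" by simp
  also have "?f (n + ?q) = A (n + ?q) $$ (a, ?r)" using past[of "n + ?q"] by simp
  also have "sum ?f {..<n} = (\<Sum>i<n. \<Sum>j<p. A i $$ (a, j) * v (int (n - i)) $ j)"
    using present by simp
  finally show ?thesis .
qed

text \<open>This is the recurrence multiplied by z^(n+1) and summed over n: the double sum becomes a
  Cauchy product, and the entry coming from the initial condition becomes the extra column. Removing
  the constant term from \<open>y\<close> keeps the value at time 0 from being counted
  twice.\<close>

lemma kneading_system:
  assumes "p > 0" and A: "\<And>n. A n \<in> carrier_mat p p" and "1 \<le> \<beta>" and a: "a < p"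
  defines "y \<equiv> \<lambda>j. Abs_fps (\<lambda>n. if n = 0 then 0
    else fib_solution p A (init_basis p \<beta>) (int n) $ j)"
  shows "y a = fps_X * (\<Sum>j<p. kneading_mat p A $$ (a, j) * y j) + fps_X * ext_entry p A a \<beta>"
proof (rule fps_ext)
  fix m
  let ?v = "fib_solution p A (init_basis p \<beta>)"
  let ?b = "\<lambda>n. A (n + (\<beta> - 1) div p) $$ (a, (\<beta> - 1) mod p)"
  show "fps_nth (y a) m = fps_nth (fps_X * (\<Sum>j<p. kneading_mat p A $$ (a, j) * y j)
      + fps_X * ext_entry p A a \<beta>) m"
  proof (cases m)
    case 0
    then show ?thesis by (simp add: y_def)
  next
    case (Suc n)
    have conv: "fps_nth (kneading_mat p A $$ (a, j) * y j) n
        = (\<Sum>i<n. A i $$ (a, j) * ?v (int (n - i)) $ j)" if "j < p" for j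
    proof -
      have "fps_nth (kneading_mat p A $$ (a, j) * y j) n
          = (\<Sum>i\<in>{0..n}. A i $$ (a, j) * (if n - i = 0 then 0 else ?v (int (n - i)) $ j))"
        using that a by (simp add: fps_mult_nth kneading_mat_def y_def)
      \<comment> \<open>The summand \<open>i = n\<close> of the convolution disappears because
        \<open>y j\<close> has constant coefficient 0.\<close>
      also have "\<dots> = (\<Sum>i<n. A i $$ (a, j) * ?v (int (n - i)) $ j)"
        by (rule sum.mono_neutral_cong_right) auto
      finally show ?thesis .
    qed
    have "fps_nth (y a) m = ?v (int (Suc n)) $ a" by (simp add: y_def Suc)
    also have "\<dots> = (\<Sum>j<p. \<Sum>i<n. A i $$ (a, j) * ?v (int (n - i)) $ j) + ?b n"
      unfolding fib_solution_init_basis_Suc[OF \<open>p > 0\<close> A a] by (subst sum.swap) (rule refl)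
    also have "\<dots> = (\<Sum>j<p. fps_nth (kneading_mat p A $$ (a, j) * y j) n) + ?b n"
      using conv by simp
    finally show ?thesis
      by (simp add: Suc fps_sum_nth ext_entry_eq[OF \<open>p > 0\<close> \<open>1 \<le> \<beta>\<close>])
  qed
qed

text \<open>Both sides agree beyond the constant coefficient, and that coefficient is read off from
  entry 0 of the initial condition.\<close>

lemma gen_fun_init_basis:
  assumes "p > 0" and "1 \<le> \<alpha>" and "\<alpha> \<le> p" and "1 \<le> \<beta>"
  shows "gen_fun p A \<alpha> (init_basis p \<beta>) = (if \<alpha> = \<beta> then 1 else 0) +
    Abs_fps (\<lambda>n. if n = 0 then 0 else fib_solution p A (init_basis p \<beta>) (int n) $ (\<alpha> - 1))"
proof -
  have "fib_solution p A (init_basis p \<beta>) 0 = init_basis p \<beta> 0"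
    using is_fib_solution_fib_solution[OF init_basis_in_init_space]
    by (simp add: is_fib_solution_def)
  moreover have "init_basis p \<beta> 0 $ (\<alpha> - 1) = (if \<alpha> = \<beta> then 1 else 0)"
  proof (cases "\<beta> \<le> p")
    case True
    then have "(\<beta> - 1) div p = 0" "(\<beta> - 1) mod p = \<beta> - 1"
      and "\<alpha> - 1 = \<beta> - 1 \<longleftrightarrow> \<alpha> = \<beta>" "\<alpha> - 1 < p" "\<beta> - 1 < p"
      using assms by auto
    then show ?thesis by (simp add: init_basis_def del: One_nat_def)
  next
    case False
    \<comment> \<open>The nonzero entry of e_\<beta> now sits at a later position, and \<alpha>
      \<le> p < \<beta>, so both sides are 0.\<close>
    then have "(\<beta> - 1) div p \<noteq> 0" using assms by (simp add: div_eq_0_iff)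
    then show ?thesis using assms False by (auto simp: init_basis_def)
  qed
  ultimately show ?thesis by (intro fps_ext) (simp add: gen_fun_def)
qed

theorem theorem3:
  fixes p :: nat and A :: "nat \<Rightarrow> complex mat" and \<alpha> \<beta> :: nat
  assumes "p > 0"
    and "\<And>n. A n \<in> carrier_mat p p"
    and "1 \<le> \<alpha>" and "\<alpha> \<le> p"
    and "1 \<le> \<beta>"
  shows "fps_X * gen_fun p A \<alpha> (init_basis p \<beta>)
       = 1 - inverse (kneading_det p A) * ext_kneading_det p A \<alpha> \<beta>"
proof -
  define y where "y j = Abs_fps (\<lambda>n. if n = 0 then 0
    else fib_solution p A (init_basis p \<beta>) (int n) $ j)" for j
  define d :: "complex fps" where "d = (if \<alpha> = \<beta> then 1 else 0)"
  define M where "M = 1\<^sub>m p - fps_X \<cdot>\<^sub>m kneading_mat p A"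
  \<comment> \<open>The sign is chosen so that \<open>M * Y\<close> is the upper part -z b of the
    last column of I - z K_\<alpha>(\<beta>).\<close>
  define Y where "Y = mat p 1 (\<lambda>(i, _). - y i)"
  \<comment> \<open>\<open>C\<close> and \<open>D\<close> form the bottom row of I - z
    K_\<alpha>(\<beta>), with columns counted from 0.\<close>
  define C :: "complex fps mat" where
    "C = mat 1 p (\<lambda>(_, j). if j = \<alpha> - 1 then - fps_X else 0)"
  define D where "D = mat 1 1 (\<lambda>_. 1 - fps_X * d)"
  have K: "kneading_mat p A \<in> carrier_mat p p" by (simp add: kneading_mat_def)
  have M: "M \<in> carrier_mat p p" unfolding M_def using K by (intro minus_carrier_mat) simp
  have Y: "Y \<in> carrier_mat p 1" and C: "C \<in> carrier_mat 1 p" and D: "D \<in> carrier_mat 1 1"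
    by (simp_all add: Y_def C_def D_def)
  have MY: "(M * Y) $$ (i, 0) = - (fps_X * ext_entry p A i \<beta>)" if i: "i < p" for i
  proof -
    have "(M * Y) $$ (i, 0) = (\<Sum>j<p. ((if i = j then 1 else 0)
        - fps_X * kneading_mat p A $$ (i, j)) * - y j)"
      using i M Y K by (simp add: scalar_prod_def atLeast0LessThan M_def Y_def)
    also have "\<dots> = (\<Sum>j<p. fps_X * (kneading_mat p A $$ (i, j) * y j) - (if i = j then y j else 0))"
      by (rule sum.cong) (auto simp: algebra_simps)
    also have "\<dots> = fps_X * (\<Sum>j<p. kneading_mat p A $$ (i, j) * y j) - y i"
      using i by (simp add: sum_subtractf sum_distrib_left)
    \<comment> \<open>Expanding this occurrence of \<open>y i\<close> cancels the sum over
      \<open>j\<close> and leaves only the extra column.\<close>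
    also have "y i = fps_X * (\<Sum>j<p. kneading_mat p A $$ (i, j) * y j)
        + fps_X * ext_entry p A i \<beta>"
      unfolding y_def by (rule kneading_system[OF assms(1,2,5) i])
    finally show ?thesis by simp
  qed
  have "1\<^sub>m (p + 1) - fps_X \<cdot>\<^sub>m ext_kneading_mat p A \<alpha> \<beta> = four_block_mat M (M * Y) C D"
  proof (rule eq_matI)
    fix i j assume "i < dim_row (four_block_mat M (M * Y) C D)"
      and "j < dim_col (four_block_mat M (M * Y) C D)"
    then have ij: "i < p + 1" "j < p + 1" using M D by auto
    then consider "i < p" "j < p" | "i < p" "j = p" | "i = p" "j < p" | "i = p" "j = p"
      by linarith
    then show "(1\<^sub>m (p + 1) - fps_X \<cdot>\<^sub>m ext_kneading_mat p A \<alpha> \<beta>) $$ (i, j)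
        = four_block_mat M (M * Y) C D $$ (i, j)"
    proof cases
      case 1
      then show ?thesis using M D K by (simp add: ext_kneading_mat_def M_def)
    next
      case 2
      \<comment> \<open>This is the only block where the recurrence enters, through
        \<open>MY\<close>.\<close>
      then show ?thesis using M D MY[of i] by (simp add: ext_kneading_mat_def del: index_mult_mat)
    next
      case 3
      then show ?thesis using M D assms(3) by (auto simp: ext_kneading_mat_def C_def)
    next
      case 4
      then show ?thesis using M D by (simp add: ext_kneading_mat_def D_def d_def)
    qed
  qed (use M D in \<open>auto simp: ext_kneading_mat_def\<close>)
  then have "ext_kneading_det p A \<alpha> \<beta> = kneading_det p A * det (D - C * Y)"
    unfolding ext_kneading_det_def kneading_det_def M_def[symmetric]
    using det_four_block_mat_right_multiple[OF M Y C D] by simp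
  also have "det (D - C * Y) = (D - C * Y) $$ (0, 0)"
    using C Y by (intro det_single minus_carrier_mat) simp
  \<comment> \<open>The signs in \<open>C\<close> and \<open>Y\<close> cancel, so the single entry
    of \<open>C * Y\<close> is z y_\<alpha>.\<close>
  also have "\<dots> = 1 - fps_X * d - (\<Sum>j<p. (if j = \<alpha> - 1 then - fps_X else 0) * - y j)"
    using C Y D by (simp add: scalar_prod_def atLeast0LessThan D_def C_def Y_def)
  also have "(\<Sum>j<p. (if j = \<alpha> - 1 then - fps_X else 0) * - y j)
      = (\<Sum>j<p. if j = \<alpha> - 1 then fps_X * y j else 0)"
    by (rule sum.cong) auto
  also have "\<dots> = fps_X * y (\<alpha> - 1)" using assms(3,4) by simp
  also have "1 - fps_X * d - fps_X * y (\<alpha> - 1) = 1 - fps_X * gen_fun p A \<alpha> (init_basis p \<beta>)"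
    unfolding gen_fun_init_basis[OF assms(1,3,4,5)] d_def y_def by (simp add: algebra_simps)
  \<comment> \<open>\<Delta> has constant coefficient 1, hence is a unit and can be divided
    out.\<close>
  finally have "inverse (kneading_det p A) * ext_kneading_det p A \<alpha> \<beta>
      = 1 - fps_X * gen_fun p A \<alpha> (init_basis p \<beta>)"
    using kneading_det_invertible[of p A] by (simp add: mult.assoc[symmetric])
  then show ?thesis by simp
qed

end
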